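(* Let $n\geq 1$ be an integer. There exists a symmetric $\mathrm{OMZD}(n)$ if and only if $n$ is even and $n\neq 4$.
   Context: An $n\times n$ real matrix $A$ is called orthogonal if $AA^{\mathrm{T}}=cI$ for some real constant $c>0$ (it is not required that $c=1$). An $\mathrm{OMZD}(n)$ (orthogonal matrix with zero diagonal) is an $n\times n$ real matrix that is orthogonal in this sense, whose diagonal entries are all zero and whose off-diagonal entries are all nonzero. It is symmetric if it equals its transpose. *)

theory Defs
  imports Complex_Main "Jordan_Normal_Form.Matrix"
begin

(* Orthogonality up to a positive scalar; distinct from the library's orthogonal_mat,
   which asks for pairwise orthogonal nonzero columns of possibly different norms. *)
definition scaled_orthogonal_mat :: "nat \<Rightarrow> real mat \<Rightarrow> bool" where
  "scaled_orthogonal_mat n A \<longleftrightarrow>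
     A \<in> carrier_mat n n \<and>
     (\<exists>c::real. c > 0 \<and> A * transpose_mat A = c \<cdot>\<^sub>m 1\<^sub>m n)"

definition OMZD :: "nat \<Rightarrow> real mat set" where
  "OMZD n = {A. scaled_orthogonal_mat n A \<and>
     (\<forall>i<n. A $$ (i, i) = 0) \<and>
     (\<forall>i<n. \<forall>j<n. i \<noteq> j \<longrightarrow> A $$ (i, j) \<noteq> 0)}"

end

theory Submission
  imports Defs "Jordan_Normal_Form.Schur_Decomposition"
begin

text \<open>A symmetric $A$ with $A A^T = cI$ satisfies $A^2 = cI$, so its eigenvalues are
  $\pm\sqrt c$; a zero diagonal makes them sum to $0$, which forces their number $n$ to be even.
  For $n = 4$ with upper rows $(a, b, c)$, $(d, e)$, $(f)$, orthogonality of the first row to the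
  others reads $bd = -ce$, $ad = -cf$, $ae = -bf$, whence $aecd = -aecd$. For $n = 2m$ with $m \neq 2$, the blocks $C = J - I$ and $D = (m-1)I - J$
  commute and $C^2 + D^2 = ((m-1)^2 + 1) I$, so the block matrix with rows $(C, D)$ and $(D, -C)$
  works; the diagonal of $D$ is $m - 2 \neq 0$.\<close>

text \<open>Each entry moves the coefficient \<open>k\<close> up or down by one, so its parity flips
  together with that of the length.\<close>

lemma sum_list_pm_eq_int_multiple:
  fixes s :: "'a :: comm_ring_1"
  assumes "\<forall>x\<in>set xs. x = s \<or> x = - s"
  shows "\<exists>k::int. sum_list xs = of_int k * s \<and> (even k \<longleftrightarrow> even (length xs))"
  using assms
proof (induction xs)
  case Nil
  then show ?case by (intro exI[of _ 0]) simp
next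
  case (Cons x xs)
  then obtain k :: int where k: "sum_list xs = of_int k * s" "even k \<longleftrightarrow> even (length xs)"
    by auto
  show ?case
  proof (cases "x = s")
    case True
    then show ?thesis using k by (intro exI[of _ "k + 1"]) (auto simp: algebra_simps)
  next
    case False
    then have "x = - s" using Cons.prems by simp
    then show ?thesis using k by (intro exI[of _ "k - 1"]) (auto simp: algebra_simps)
  qed
qed

text \<open>Cyclicity of the trace: both sides are the same double sum in opposite orders. It yields
  similarity invariance below.\<close>

lemma sum_diag_mult_commute:
  fixes A B :: "'a :: comm_semiring_0 mat"
  assumes "A \<in> carrier_mat n m" "B \<in> carrier_mat m n"
  shows "(\<Sum>i<n. (A * B) $$ (i, i)) = (\<Sum>i<m. (B * A) $$ (i, i))"
proof -
  have "(\<Sum>i<n. (A * B) $$ (i, i)) = (\<Sum>i<n. \<Sum>k<m. A $$ (i, k) * B $$ (k, i))"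
    using assms by (intro sum.cong refl) (auto simp: scalar_prod_def atLeast0LessThan)
  also have "\<dots> = (\<Sum>k<m. \<Sum>i<n. B $$ (k, i) * A $$ (i, k))"
    by (subst sum.swap) (simp add: mult.commute)
  also have "\<dots> = (\<Sum>i<m. (B * A) $$ (i, i))"
    using assms by (intro sum.cong refl) (auto simp: scalar_prod_def atLeast0LessThan)
  finally show ?thesis .
qed

text \<open>Schur triangularisation makes \<open>A\<close> similar to a matrix \<open>B\<close>
  whose diagonal is exactly \<open>es\<close>, and the trace is invariant under similarity.\<close>

lemma sum_diag_eq_sum_list_eigenvalues:
  fixes A :: "'a :: conjugatable_ordered_field mat"
  assumes A: "A \<in> carrier_mat n n" and es: "char_poly A = (\<Prod>e\<leftarrow>es. [:- e, 1:])"
  shows "(\<Sum>i<n. A $$ (i, i)) = sum_list es"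
proof -
  obtain B P Q where BPQ: "schur_decomposition A es = (B, P, Q)"
    by (cases "schur_decomposition A es") auto
  from schur_decomposition[OF A es BPQ]
  have sim: "similar_mat_wit A B P Q" and diag: "diag_mat B = es" by auto
  note w = similar_mat_witD2[OF A sim]
  have "(\<Sum>i<n. A $$ (i, i)) = (\<Sum>i<n. ((P * B) * Q) $$ (i, i))" using w by simp
  also have "\<dots> = (\<Sum>i<n. (Q * (P * B)) $$ (i, i))"
    using w by (intro sum_diag_mult_commute) auto
  also have "Q * (P * B) = (Q * P) * B" using w by (metis assoc_mult_mat)
  also have "\<dots> = B" using w by simp
  also have "(\<Sum>i<n. B $$ (i, i)) = sum_list es"
    using w by (simp add: diag[symmetric] diag_mat_def interv_sum_list_conv_sum_set_nat
        atLeast0LessThan)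
  finally show ?thesis .
qed

lemma even_dim_if_square_scalar_trace_0:
  fixes A :: "real mat"
  assumes A: "A \<in> carrier_mat n n" and sq: "A * A = c \<cdot>\<^sub>m 1\<^sub>m n" and c: "c > 0"
    and trace: "(\<Sum>i<n. A $$ (i, i)) = 0"
  shows "even n"
proof -
  \<comment> \<open>Over the complex numbers the characteristic polynomial splits, giving a list of
    exactly \<open>n\<close> eigenvalues with multiplicity.\<close>
  define M where "M = map_mat complex_of_real A"
  have M: "M \<in> carrier_mat n n" using A by (simp add: M_def)
  have "M * M = map_mat complex_of_real (A * A)"
    unfolding M_def using of_real_hom.mat_hom_mult[OF A A] by metis
  also have "\<dots> = complex_of_real c \<cdot>\<^sub>m 1\<^sub>m n" unfolding sq by (rule eq_matI) auto
  finally have MM: "M * M = complex_of_real c \<cdot>\<^sub>m 1\<^sub>m n" .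
  obtain es where es: "char_poly M = (\<Prod>e\<leftarrow>es. [:- e, 1:])" and len: "length es = n"
    using char_poly_factorized[OF M] by blast
  define s where "s = complex_of_real (sqrt c)"
  have s2: "s * s = complex_of_real c" unfolding s_def using c
    by (metis of_real_mult real_sqrt_mult_self abs_of_pos)
  have "e = s \<or> e = - s" if "e \<in> set es" for e
  proof -
    have "poly (char_poly M) e = 0"
      unfolding es poly_prod_list using that by (auto simp: prod_list_zero_iff)
    then have "eigenvalue M e" using eigenvalue_root_char_poly[OF M] by simp
    then obtain v where v: "v \<in> carrier_vec n" "v \<noteq> 0\<^sub>v n" "M *\<^sub>v v = e \<cdot>\<^sub>v v"
      using M by (auto simp: eigenvalue_def eigenvector_def)
    \<comment> \<open>Applying \<open>M * M\<close> to an eigenvector in two ways, then comparing a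
      nonzero entry, gives \<open>e * e = c\<close>.\<close>
    have "complex_of_real c \<cdot>\<^sub>v v = (M * M) *\<^sub>v v"
      unfolding MM using v(1) by (intro eq_vecI) auto
    also have "\<dots> = (e * e) \<cdot>\<^sub>v v"
      using M v by (simp add: assoc_mult_mat_vec[of _ n n _ n] mult_mat_vec smult_smult_assoc)
    finally have eq: "complex_of_real c \<cdot>\<^sub>v v = (e * e) \<cdot>\<^sub>v v" .
    obtain i where i: "i < n" "v $ i \<noteq> 0" using v(1,2) by (metis carrier_vecD eq_vecI index_zero_vec)
    have "complex_of_real c * v $ i = (e * e) * v $ i"
      using arg_cong[OF eq, of "\<lambda>w. w $ i"] i v(1) by simp
    then have "e * e = s * s" using i s2 by simp
    then show ?thesis by (simp add: square_eq_iff)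
  qed
  then obtain k :: int where k: "sum_list es = of_int k * s" "even k \<longleftrightarrow> even n"
    using sum_list_pm_eq_int_multiple[of es s] len by auto
  have "sum_list es = complex_of_real (\<Sum>i<n. A $$ (i, i))"
    using A by (simp add: sum_diag_eq_sum_list_eigenvalues[OF M es, symmetric] M_def)
  \<comment> \<open>The trace is \<open>k\<close> times the nonzero number \<open>s\<close>, so it
    vanishes only for \<open>k = 0\<close>; \<open>k\<close> has the parity of
    \<open>n\<close>.\<close>
  then have "of_int k * s = 0" using k trace by simp
  then have "k = 0" using c by (simp add: s_def)
  then show ?thesis using k by simp
qed

lemma no_symmetric_OMZD_4:
  assumes A: "A \<in> OMZD 4" and sym: "transpose_mat A = A"
  shows False
proof -
  have carr: "A \<in> carrier_mat 4 4" using A by (simp add: OMZD_def scaled_orthogonal_mat_def)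
  obtain c where c: "A * transpose_mat A = c \<cdot>\<^sub>m 1\<^sub>m 4"
    using A by (auto simp: OMZD_def scaled_orthogonal_mat_def)
  have orth: "(\<Sum>k<4. A $$ (i, k) * A $$ (j, k)) = 0" if "i < 4" "j < 4" "i \<noteq> j" for i j
    using arg_cong[OF c, of "\<lambda>M. M $$ (i, j)"] that carr
    by (simp add: scalar_prod_def atLeast0LessThan)
  have s: "A $$ (j, i) = A $$ (i, j)" if "i < 4" "j < 4" for i j
    using that carr sym by (metis carrier_matD index_transpose_mat(1))
  have z: "A $$ (i, i) = 0" if "i < 4" for i using A that by (simp add: OMZD_def)
  have nz: "A $$ (i, j) \<noteq> 0" if "i < 4" "j < 4" "i \<noteq> j" for i j
    using A that by (simp add: OMZD_def)
  let ?a = "A $$ (0, 1)" and ?b = "A $$ (0, 2)" and ?c = "A $$ (0, 3)"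
    and ?d = "A $$ (1, 2)" and ?e = "A $$ (1, 3)" and ?f = "A $$ (2, 3)"
  have set4: "{..<4} = {0, 1, 2, 3 :: nat}" by auto
  \<comment> \<open>In the product of rows i and j, columns i and j each meet a diagonal zero, so
    only two terms survive.\<close>
  have bd: "?b * ?d = - (?c * ?e)" using orth[of 0 1] by (simp add: set4 z s)
  have ad: "?a * ?d = - (?c * ?f)" using orth[of 0 2] s[of 1 2] by (simp add: set4 z)
  have ae: "?a * ?e = - (?b * ?f)"
    using orth[of 0 3] s[of 1 3] s[of 2 3] by (simp add: set4 z)
  \<comment> \<open>Each relation is used once. Their three minus signs turn a product of nonzero
    entries into its own negative.\<close>
  have "?a * ?e * (?c * ?d) = - (?b * ?d) * (?c * ?f)" unfolding ae by simp
  also have "\<dots> = - (?c * ?e) * (?a * ?d)" unfolding bd ad by simp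
  also have "\<dots> = - (?a * ?e * (?c * ?d))" by simp
  finally have "?a * ?e * (?c * ?d) = 0" by simp
  then show False using nz[of 0 1] nz[of 1 3] nz[of 0 3] nz[of 1 2] by simp
qed

text \<open>This is aI + bJ, with J the all-ones matrix. The family contains both blocks of the
  construction and is closed under sums and products.\<close>

definition scalar_plus_const_mat :: "nat \<Rightarrow> 'a \<Rightarrow> 'a \<Rightarrow> 'a :: comm_ring_1 mat" where
  "scalar_plus_const_mat m a b = mat m m (\<lambda>(i, j). (if i = j then a else 0) + b)"

lemma scalar_plus_const_mat_carrier [simp]: "scalar_plus_const_mat m a b \<in> carrier_mat m m"
  by (simp add: scalar_plus_const_mat_def)

lemma scalar_plus_const_mat_dim [simp]:
  "dim_row (scalar_plus_const_mat m a b) = m" "dim_col (scalar_plus_const_mat m a b) = m"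
  by (simp_all add: scalar_plus_const_mat_def)

lemma scalar_plus_const_mat_index [simp]:
  "i < m \<Longrightarrow> j < m \<Longrightarrow> scalar_plus_const_mat m a b $$ (i, j) = (if i = j then a else 0) + b"
  by (simp add: scalar_plus_const_mat_def)

lemma transpose_scalar_plus_const_mat [simp]:
  "transpose_mat (scalar_plus_const_mat m a b) = scalar_plus_const_mat m a b"
  by (rule eq_matI) auto

lemma add_scalar_plus_const_mat:
  "scalar_plus_const_mat m a b + scalar_plus_const_mat m a' b' = scalar_plus_const_mat m (a + a') (b + b')"
  by (rule eq_matI) auto

text \<open>Expand (aI + bJ)(a'I + b'J) using J^2 = mJ.\<close>

lemma mult_scalar_plus_const_mat:
  "scalar_plus_const_mat m a b * scalar_plus_const_mat m a' b' =
    scalar_plus_const_mat m (a * a') (a * b' + b * a' + of_nat m * b * b')"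
proof (rule eq_matI)
  fix i j
  assume "i < dim_row (scalar_plus_const_mat m (a * a') (a * b' + b * a' + of_nat m * b * b'))"
    and "j < dim_col (scalar_plus_const_mat m (a * a') (a * b' + b * a' + of_nat m * b * b'))"
  then have ij: "i < m" "j < m" by auto
  have "(scalar_plus_const_mat m a b * scalar_plus_const_mat m a' b') $$ (i, j)
      = (\<Sum>k<m. ((if i = k then a else 0) + b) * ((if k = j then a' else 0) + b'))"
    using ij by (simp add: scalar_prod_def atLeast0LessThan)
  \<comment> \<open>Under \<open>i = k\<close> the test \<open>k = j\<close> becomes
    \<open>i = j\<close>, so every conditional summand singles out one value of
    \<open>k\<close>.\<close>
  also have "\<dots> = (\<Sum>k<m. (if i = k then a * (if i = j then a' else 0) + a * b' else 0)
      + ((if k = j then b * a' else 0) + b * b'))"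
    by (intro sum.cong) (auto simp: algebra_simps)
  also have "\<dots> = (if i = j then a * a' else 0) + (a * b' + b * a' + of_nat m * b * b')"
    using ij by (simp add: sum.distrib algebra_simps)
  finally show "(scalar_plus_const_mat m a b * scalar_plus_const_mat m a' b') $$ (i, j)
      = scalar_plus_const_mat m (a * a') (a * b' + b * a' + of_nat m * b * b') $$ (i, j)"
    using ij by simp
qed auto

lemma symmetric_OMZD_double:
  assumes "m \<noteq> 2"
  shows "\<exists>A. A \<in> OMZD (m + m) \<and> transpose_mat A = A"
proof -
  let ?K = "scalar_plus_const_mat m :: real \<Rightarrow> _"
  \<comment> \<open>For C = J - I and D = rI - J, the coefficient of J in C^2 + D^2 is (m - 2) + (m
    - 2r), which vanishes for r = m - 1.\<close>
  let ?r = "real m - 1"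
  define A where "A = four_block_mat (?K (- 1) 1) (?K ?r (- 1)) (?K ?r (- 1)) (?K 1 (- 1))"
  have carr: "A \<in> carrier_mat (m + m) (m + m)" by (simp add: A_def)
  have sym: "transpose_mat A = A"
    unfolding A_def by (subst transpose_four_block_mat[where ?nr1.0 = m and ?nc1.0 = m
          and ?nr2.0 = m and ?nc2.0 = m]) simp_all
  \<comment> \<open>The diagonal blocks are C^2 + D^2; the others are CD - DC and its negative, zero
    because polynomials in J commute.\<close>
  have "A * A = four_block_mat (?K (1 + ?r\<^sup>2) 0) (?K 0 0) (?K 0 0) (?K (1 + ?r\<^sup>2) 0)"
    unfolding A_def
    by (subst mult_four_block_mat[where ?nr1.0 = m and ?n1.0 = m and ?n2.0 = m and ?nr2.0 = m
          and ?nc1.0 = m and ?nc2.0 = m])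
      (simp_all add: mult_scalar_plus_const_mat add_scalar_plus_const_mat power2_eq_square
        algebra_simps)
  also have "\<dots> = (1 + ?r\<^sup>2) \<cdot>\<^sub>m 1\<^sub>m (m + m)"
    by (rule eq_matI) auto
  finally have "A * transpose_mat A = (1 + ?r\<^sup>2) \<cdot>\<^sub>m 1\<^sub>m (m + m)" by (simp add: sym)
  moreover have "1 + ?r\<^sup>2 > 0" by (simp add: add_pos_nonneg)
  ultimately have "scaled_orthogonal_mat (m + m) A"
    using carr unfolding scaled_orthogonal_mat_def by blast
  moreover have "\<forall>i<m + m. A $$ (i, i) = 0" by (auto simp: A_def)
  \<comment> \<open>All these entries are 1 or -1, except the diagonal of D, which is m - 2.\<close>
  moreover have "\<forall>i<m + m. \<forall>j<m + m. i \<noteq> j \<longrightarrow> A $$ (i, j) \<noteq> 0"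
    using assms by (auto simp: A_def)
  ultimately show ?thesis using sym by (auto simp: OMZD_def)
qed

theorem theorem3p2:
  fixes n :: nat
  assumes "n \<ge> 1"
  shows "(\<exists>A. A \<in> OMZD n \<and> transpose_mat A = A) \<longleftrightarrow> even n \<and> n \<noteq> 4"
proof
  assume "\<exists>A. A \<in> OMZD n \<and> transpose_mat A = A"
  then obtain A where A: "A \<in> OMZD n" and sym: "transpose_mat A = A" by blast
  then obtain c where "A \<in> carrier_mat n n" "c > 0" "A * A = c \<cdot>\<^sub>m 1\<^sub>m n"
    by (auto simp: OMZD_def scaled_orthogonal_mat_def)
  moreover have "(\<Sum>i<n. A $$ (i, i)) = 0" using A by (simp add: OMZD_def)
  ultimately have "even n" by (intro even_dim_if_square_scalar_trace_0)
  moreover have "n \<noteq> 4" using A sym no_symmetric_OMZD_4 by blast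
  ultimately show "even n \<and> n \<noteq> 4" by simp
next
  assume n: "even n \<and> n \<noteq> 4"
  then obtain m where "n = m + m" by (metis evenE mult_2)
  with n show "\<exists>A. A \<in> OMZD n \<and> transpose_mat A = A"
    using symmetric_OMZD_double[of m] by auto
qed

end
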